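(* Let $\mathsf{L}$ be a logical calculus of intuitionistic logic or of normal modal logic in the language $\mathcal{L}$, understood as a set of $\Pi_1$-rules and algebraized by a class of Heyting (respectively modal) algebras. Let $\Sigma$ be a collection of $\Pi_2$-rules in the language $\mathcal{L}$, and let $\mathsf{L}\oplus\Sigma$ be the smallest $\Pi_2$-rule system containing the rules of $\mathsf{L}$ and the rules of $\Sigma$. If $\Gamma/^2\phi$ is a $\Pi_2$-rule with $\Gamma/^2\phi\notin\mathsf{L}\oplus\Sigma$, then there is an $\mathcal{L}$-algebra $\mathcal{A}$ such that $\mathcal{A}$ validates every rule of $\mathsf{L}\oplus\Sigma$ and $\mathcal{A}\nvDash\Gamma/^2\phi$.
   Context: A $\Pi_2$-rule is a triple $(\Gamma,\psi,F)$, written $\tilde\forall\overline{q}\,\Gamma\vdash\psi$ or $\Gamma/^2\psi$, where $\Gamma=\{\phi_i(\overline p,\overline q):i\le n\}$ is a finite set of $\mathcal{L}$-formulas, $\psi(\overline p)$ is a formula containing at most the variables $\overline p$, and $F=\{\overline q\}$ (the bound context $B_c(\Gamma)$) is a set of propositional letters not occurring in $\psi$. If $F=\emptyset$ it is a $\Pi_1$-rule. For an $\mathcal{L}$-algebra $\mathcal{A}$ and valuation $v$ of the propositional variables in $\mathcal{A}$, $(\mathcal{A},v)\vDash\Gamma/^2\psi$ means: if $v'(\phi)=1$ for every $\phi\in\Gamma$ and every valuation $v'$ agreeing with $v$ outside $F$, then $v(\psi)=1$. $\mathcal{A}\vDash\Gamma/^2\psi$ means this holds for every $v$; equivalently $\mathcal{A}$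 satisfies the first-order sentence $\forall\overline y(\forall\overline x(\bigwedge\Gamma(\overline x,\overline y)\approx1)\to\psi(\overline y)\approx1)$. A $\Pi_2$-rule system is a set $\vdash$ of $\Pi_2$-rules satisfying: (Strong Reflexivity) if $\chi\in\Gamma$ and $\overline\phi$ are formulas not containing variables of $\overline p$, then $\tilde\forall\overline p\,\Gamma\vdash\chi[\overline\phi/\overline p]$; (Monotonicity) if $\tilde\forall\overline p\,\Gamma\vdash\psi$ then $\tilde\forall\overline p\,(\Gamma\cup\Gamma')\vdash\psi$ for every finite $\Gamma'$; ($\alpha$-renaming) if $\tilde\forall\overline p\,\Gamma\vdash\psi$ then $\tilde\forall\overline q\,\Gamma[\overline q/\overline p]\vdash\psi$ whenever no variable of $\overline q$ occurs free in $\Gamma$ or $\psi$; (Rule cut) if $\Gamma(\overline p,\overline r)$ and $\Delta(\overline q,\overline r)=\{\mu_i(\overline q,\overline r):i\le n\}$ are finite sets, $\psi$ contains no variable of $\overline r$ or $\overline q$, $\Gamma$ contains no variable of $\overline q$, $\tilde\forall\overline p\,\Gamma\vdash\mu_i$ for each $i\le n$ and $\tilde\forall\overline q\,\Delta\vdash\psi$, then $\tilde\forall\overline p\,\Gamma\vdash\psi$; (Bound Structurality) if $\tilde\forall\overline p\,\Gamma\vdash\psi$ and $\sigma$ is a substitution fixing every variable of $\overline p$ such that no $p\in\overline p$ occurs in $\sigma(q)$ for $q$ free in $\Gamma$, then $\tilde\forall\overline p\,\sigma[\Gamma]\vdash\sigma(\psi)$. Intersections of $\Pi_2$-rule systems are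 $\Pi_2$-rule systems, so smallest ones containing a given set of rules exist.
   Formalization: Rule cut lets ψ share free letters with Γ and Δ (only bound letters are barred from ψ), since with ψ free of r the claim fails for IPC plus p∨¬p; renamed bound letters are distinct, and in Bound Structurality σ(ψ) must contain no bound letter. *)

theory Defs
  imports Main
begin

datatype lang = Intuitionistic | Modal

datatype fm =
    Var nat
  | Bot
  | Top
  | Conj fm fm
  | Disj fm fm
  | Impl fm fm
  | Box fm

primrec vars :: "fm \<Rightarrow> nat set" where
  "vars (Var x) = {x}"
| "vars Bot = {}"
| "vars Top = {}"
| "vars (Conj a b) = vars a \<union> vars b"
| "vars (Disj a b) = vars a \<union> vars b"
| "vars (Impl a b) = vars a \<union> vars b"
| "vars (Box a) = vars a"

primrec box_free :: "fm \<Rightarrow> bool" where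
  "box_free (Var x) = True"
| "box_free Bot = True"
| "box_free Top = True"
| "box_free (Conj a b) = (box_free a \<and> box_free b)"
| "box_free (Disj a b) = (box_free a \<and> box_free b)"
| "box_free (Impl a b) = (box_free a \<and> box_free b)"
| "box_free (Box a) = False"

fun forms :: "lang \<Rightarrow> fm set" where
  "forms Intuitionistic = {\<phi>. box_free \<phi>}"
| "forms Modal = UNIV"

primrec subst :: "(nat \<Rightarrow> fm) \<Rightarrow> fm \<Rightarrow> fm" where
  "subst \<sigma> (Var x) = \<sigma> x"
| "subst \<sigma> Bot = Bot"
| "subst \<sigma> Top = Top"
| "subst \<sigma> (Conj a b) = Conj (subst \<sigma> a) (subst \<sigma> b)"
| "subst \<sigma> (Disj a b) = Disj (subst \<sigma> a) (subst \<sigma> b)"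
| "subst \<sigma> (Impl a b) = Impl (subst \<sigma> a) (subst \<sigma> b)"
| "subst \<sigma> (Box a) = Box (subst \<sigma> a)"

definition substitution :: "lang \<Rightarrow> (nat \<Rightarrow> fm) \<Rightarrow> bool" where
  "substitution l \<sigma> \<longleftrightarrow> (\<forall>x. \<sigma> x \<in> forms l)"

text \<open>The field \<open>box\<close> carries no meaning for an algebra of the intuitionistic language:
  it is unconstrained there and is never used in evaluating box-free formulas.\<close>

record 'a alg =
  carrier :: "'a set"
  one :: 'a
  zero :: 'a
  meet :: "'a \<Rightarrow> 'a \<Rightarrow> 'a"
  join :: "'a \<Rightarrow> 'a \<Rightarrow> 'a"
  imp :: "'a \<Rightarrow> 'a \<Rightarrow> 'a"
  box :: "'a \<Rightarrow> 'a"

definition below :: "'a alg \<Rightarrow> 'a \<Rightarrow> 'a \<Rightarrow> bool" where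
  "below A a b \<longleftrightarrow> meet A a b = a"

locale heyting_algebra =
  fixes A :: "'a alg"
  assumes one_closed: "one A \<in> carrier A"
    and zero_closed: "zero A \<in> carrier A"
    and meet_closed: "a \<in> carrier A \<Longrightarrow> b \<in> carrier A \<Longrightarrow> meet A a b \<in> carrier A"
    and join_closed: "a \<in> carrier A \<Longrightarrow> b \<in> carrier A \<Longrightarrow> join A a b \<in> carrier A"
    and imp_closed: "a \<in> carrier A \<Longrightarrow> b \<in> carrier A \<Longrightarrow> imp A a b \<in> carrier A"
    and meet_assoc: "a \<in> carrier A \<Longrightarrow> b \<in> carrier A \<Longrightarrow> c \<in> carrier A \<Longrightarrow>
      meet A (meet A a b) c = meet A a (meet A b c)"
    and join_assoc: "a \<in> carrier A \<Longrightarrow> b \<in> carrier A \<Longrightarrow> c \<in> carrier A \<Longrightarrow>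
      join A (join A a b) c = join A a (join A b c)"
    and meet_comm: "a \<in> carrier A \<Longrightarrow> b \<in> carrier A \<Longrightarrow> meet A a b = meet A b a"
    and join_comm: "a \<in> carrier A \<Longrightarrow> b \<in> carrier A \<Longrightarrow> join A a b = join A b a"
    and meet_absorb: "a \<in> carrier A \<Longrightarrow> b \<in> carrier A \<Longrightarrow> meet A a (join A a b) = a"
    and join_absorb: "a \<in> carrier A \<Longrightarrow> b \<in> carrier A \<Longrightarrow> join A a (meet A a b) = a"
    and meet_one: "a \<in> carrier A \<Longrightarrow> meet A a (one A) = a"
    and join_zero: "a \<in> carrier A \<Longrightarrow> join A a (zero A) = a"
    and residuation: "a \<in> carrier A \<Longrightarrow> b \<in> carrier A \<Longrightarrow> c \<in> carrier A \<Longrightarrow>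
      below A (meet A c a) b \<longleftrightarrow> below A c (imp A a b)"

text \<open>A Boolean algebra in the signature with implication is a Heyting algebra satisfying
  excluded middle, the complement of \<open>a\<close> being \<open>a \<rightarrow> 0\<close>.\<close>

locale modal_algebra = heyting_algebra +
  assumes excluded_middle: "a \<in> carrier A \<Longrightarrow> join A a (imp A a (zero A)) = one A"
    and box_closed: "a \<in> carrier A \<Longrightarrow> box A a \<in> carrier A"
    and box_one: "box A (one A) = one A"
    and box_meet: "a \<in> carrier A \<Longrightarrow> b \<in> carrier A \<Longrightarrow>
      box A (meet A a b) = meet A (box A a) (box A b)"

fun lang_algebra :: "lang \<Rightarrow> 'a alg \<Rightarrow> bool" where
  "lang_algebra Intuitionistic A = heyting_algebra A"
| "lang_algebra Modal A = modal_algebra A"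

definition valuation :: "'a alg \<Rightarrow> (nat \<Rightarrow> 'a) \<Rightarrow> bool" where
  "valuation A v \<longleftrightarrow> (\<forall>x. v x \<in> carrier A)"

primrec eval :: "'a alg \<Rightarrow> (nat \<Rightarrow> 'a) \<Rightarrow> fm \<Rightarrow> 'a" where
  "eval A v (Var x) = v x"
| "eval A v Bot = zero A"
| "eval A v Top = one A"
| "eval A v (Conj a b) = meet A (eval A v a) (eval A v b)"
| "eval A v (Disj a b) = join A (eval A v a) (eval A v b)"
| "eval A v (Impl a b) = imp A (eval A v a) (eval A v b)"
| "eval A v (Box a) = box A (eval A v a)"

text \<open>A triple \<open>(\<Gamma>, \<psi>, F)\<close>: premises, conclusion, bound context. The bound context is given by
  a tuple of letters, hence finite; its letters need not occur in \<open>\<Gamma>\<close>.\<close>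

type_synonym pi2_rule = "fm set \<times> fm \<times> nat set"

definition pi2_rules :: "lang \<Rightarrow> pi2_rule set" where
  "pi2_rules l = {(\<Gamma>, \<psi>, F). finite \<Gamma> \<and> \<Gamma> \<subseteq> forms l \<and> \<psi> \<in> forms l \<and> finite F \<and> F \<inter> vars \<psi> = {}}"

definition pi1_rules :: "lang \<Rightarrow> pi2_rule set" where
  "pi1_rules l = {(\<Gamma>, \<psi>, F) \<in> pi2_rules l. F = {}}"

fun satisfies :: "'a alg \<Rightarrow> (nat \<Rightarrow> 'a) \<Rightarrow> pi2_rule \<Rightarrow> bool" where
  "satisfies A v (\<Gamma>, \<psi>, F) \<longleftrightarrow>
    ((\<forall>\<phi>\<in>\<Gamma>. \<forall>v'. valuation A v' \<and> (\<forall>x. x \<notin> F \<longrightarrow> v' x = v x) \<longrightarrow> eval A v' \<phi> = one A)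
      \<longrightarrow> eval A v \<psi> = one A)"

definition validates :: "'a alg \<Rightarrow> pi2_rule \<Rightarrow> bool" where
  "validates A R \<longleftrightarrow> (\<forall>v. valuation A v \<longrightarrow> satisfies A v R)"

definition free_vars :: "fm set \<Rightarrow> nat set \<Rightarrow> nat set" where
  "free_vars \<Gamma> F = \<Union> (vars ` \<Gamma>) - F"

definition strong_reflexivity :: "lang \<Rightarrow> pi2_rule set \<Rightarrow> bool" where
  "strong_reflexivity l S \<longleftrightarrow>
    (\<forall>\<Gamma> F \<chi> \<sigma>. finite \<Gamma> \<and> \<Gamma> \<subseteq> forms l \<and> finite F \<and> \<chi> \<in> \<Gamma> \<and>
      (\<forall>p\<in>F. \<sigma> p \<in> forms l \<and> vars (\<sigma> p) \<inter> F = {}) \<longrightarrow>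
      (\<Gamma>, subst (\<lambda>x. if x \<in> F then \<sigma> x else Var x) \<chi>, F) \<in> S)"

definition monotonicity :: "lang \<Rightarrow> pi2_rule set \<Rightarrow> bool" where
  "monotonicity l S \<longleftrightarrow>
    (\<forall>\<Gamma> \<Gamma>' \<psi> F. (\<Gamma>, \<psi>, F) \<in> S \<and> finite \<Gamma>' \<and> \<Gamma>' \<subseteq> forms l \<longrightarrow> (\<Gamma> \<union> \<Gamma>', \<psi>, F) \<in> S)"

text \<open>The new tuple of bound letters is \<open>f ` F\<close>; it consists of distinct letters, so \<open>f\<close> is
  injective on \<open>F\<close>. It may share letters with \<open>F\<close>.\<close>

definition alpha_renaming :: "pi2_rule set \<Rightarrow> bool" where
  "alpha_renaming S \<longleftrightarrow>
    (\<forall>\<Gamma> \<psi> F f. (\<Gamma>, \<psi>, F) \<in> S \<and> inj_on f F \<and>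
      f ` F \<inter> free_vars \<Gamma> F = {} \<and> f ` F \<inter> vars \<psi> = {} \<longrightarrow>
      (subst (\<lambda>x. if x \<in> F then Var (f x) else Var x) ` \<Gamma>, \<psi>, f ` F) \<in> S)"

text \<open>The cut eliminates the members of \<open>\<Delta>\<close>. Letters occurring free in \<open>\<Gamma>\<close> and \<open>\<Delta>\<close> may occur
  in \<open>\<psi>\<close> as parameters; only bound letters are excluded from \<open>\<psi>\<close>. That no member of \<open>F\<close> occurs
  in \<open>\<Delta>\<close> is part of \<open>(\<Gamma>, \<mu>, F)\<close> being a rule.\<close>

definition rule_cut :: "lang \<Rightarrow> pi2_rule set \<Rightarrow> bool" where
  "rule_cut l S \<longleftrightarrow>
    (\<forall>\<Gamma> F \<Delta> G \<psi>. (\<forall>\<mu>\<in>\<Delta>. (\<Gamma>, \<mu>, F) \<in> S) \<and> (\<Delta>, \<psi>, G) \<in> S \<and>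
      finite \<Gamma> \<and> \<Gamma> \<subseteq> forms l \<and> finite F \<and> \<Union> (vars ` \<Gamma>) \<inter> G = {} \<and> vars \<psi> \<inter> (F \<union> G) = {} \<longrightarrow>
      (\<Gamma>, \<psi>, F) \<in> S)"

text \<open>The condition \<open>vars (subst \<sigma> \<psi>) \<inter> F = {}\<close> makes the resulting triple a rule; it does
  not follow from the condition on \<open>\<Gamma>\<close> when \<open>\<psi>\<close> has letters not occurring in \<open>\<Gamma>\<close>.\<close>

definition bound_structurality :: "lang \<Rightarrow> pi2_rule set \<Rightarrow> bool" where
  "bound_structurality l S \<longleftrightarrow>
    (\<forall>\<Gamma> \<psi> F \<sigma>. (\<Gamma>, \<psi>, F) \<in> S \<and> substitution l \<sigma> \<and> (\<forall>p\<in>F. \<sigma> p = Var p) \<and>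
      (\<forall>q\<in>free_vars \<Gamma> F. vars (\<sigma> q) \<inter> F = {}) \<and> vars (subst \<sigma> \<psi>) \<inter> F = {} \<longrightarrow>
      (subst \<sigma> ` \<Gamma>, subst \<sigma> \<psi>, F) \<in> S)"

definition pi2_rule_system :: "lang \<Rightarrow> pi2_rule set \<Rightarrow> bool" where
  "pi2_rule_system l S \<longleftrightarrow> S \<subseteq> pi2_rules l \<and> strong_reflexivity l S \<and> monotonicity l S \<and>
    alpha_renaming S \<and> rule_cut l S \<and> bound_structurality l S"

definition oplus :: "lang \<Rightarrow> pi2_rule set \<Rightarrow> pi2_rule set \<Rightarrow> pi2_rule set" where
  "oplus l L \<Sigma> = \<Inter> {S. pi2_rule_system l S \<and> L \<union> \<Sigma> \<subseteq> S}"

inductive derivable :: "lang \<Rightarrow> pi2_rule set \<Rightarrow> fm set \<Rightarrow> fm \<Rightarrow> bool"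
  for l L \<Gamma> where
  premise: "\<phi> \<in> \<Gamma> \<Longrightarrow> derivable l L \<Gamma> \<phi>"
| rule: "(\<Delta>, \<psi>, {}) \<in> L \<Longrightarrow> substitution l \<sigma> \<Longrightarrow>
    (\<And>\<delta>. \<delta> \<in> \<Delta> \<Longrightarrow> derivable l L \<Gamma> (subst \<sigma> \<delta>)) \<Longrightarrow> derivable l L \<Gamma> (subst \<sigma> \<psi>)"

text \<open>Algebraization with defining equation \<open>x \<approx> 1\<close> and equivalence formula \<open>x \<leftrightarrow> y\<close>. The
  remaining clause, that \<open>x \<approx> y\<close> and \<open>(x \<leftrightarrow> y) \<approx> 1\<close> are interderivable over \<open>K\<close>, holds in every
  Heyting algebra.\<close>

definition algebraized_by :: "lang \<Rightarrow> pi2_rule set \<Rightarrow> 'a alg set \<Rightarrow> bool" where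
  "algebraized_by l L K \<longleftrightarrow> (\<forall>A\<in>K. lang_algebra l A) \<and>
    (\<forall>\<Gamma> \<phi>. (\<Gamma>, \<phi>, {}) \<in> pi1_rules l \<longrightarrow>
      (derivable l L \<Gamma> \<phi> \<longleftrightarrow> (\<forall>A\<in>K. validates A (\<Gamma>, \<phi>, {}))))"

lemma finite_vars: "finite (vars \<phi>)"
  by (induction \<phi>) auto

lemma subst_forms:
  assumes "\<phi> \<in> forms l" "\<And>x. x \<in> vars \<phi> \<Longrightarrow> \<sigma> x \<in> forms l"
  shows "subst \<sigma> \<phi> \<in> forms l"
  using assms by (cases l; induction \<phi>) auto

lemma vars_subst: "vars (subst \<sigma> \<phi>) = (\<Union>x\<in>vars \<phi>. vars (\<sigma> x))"
  by (induction \<phi>) auto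

lemma Var_forms [simp]: "Var x \<in> forms l"
  by (cases l) auto

lemma pi2_rule_system_all: "pi2_rule_system l (pi2_rules l)"
proof -
  have "strong_reflexivity l (pi2_rules l)"
    unfolding strong_reflexivity_def pi2_rules_def
    by (auto simp: vars_subst disjoint_iff intro!: subst_forms split: if_splits)
  moreover have "monotonicity l (pi2_rules l)"
    unfolding monotonicity_def pi2_rules_def by auto
  moreover have "alpha_renaming (pi2_rules l)"
    unfolding alpha_renaming_def pi2_rules_def by (auto intro!: subst_forms)
  moreover have "rule_cut l (pi2_rules l)"
    unfolding rule_cut_def pi2_rules_def by auto
  moreover have "bound_structurality l (pi2_rules l)"
    unfolding bound_structurality_def pi2_rules_def substitution_def
    by (auto intro!: subst_forms)
  ultimately show ?thesis
    unfolding pi2_rule_system_def by blast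
qed

lemma pi2_rule_system_oplus:
  assumes "L \<subseteq> pi2_rules l" "\<Sigma> \<subseteq> pi2_rules l"
  shows "pi2_rule_system l (oplus l L \<Sigma>)"
proof -
  define \<S> where "\<S> = {S. pi2_rule_system l S \<and> L \<union> \<Sigma> \<subseteq> S}"
  have sys: "pi2_rule_system l S" if "S \<in> \<S>" for S
    using that by (simp add: \<S>_def)
  have all: "pi2_rules l \<in> \<S>"
    using assms pi2_rule_system_all by (simp add: \<S>_def)
  have "\<Inter> \<S> \<subseteq> pi2_rules l"
    using all by blast
  moreover have "strong_reflexivity l (\<Inter> \<S>)"
    using sys unfolding pi2_rule_system_def strong_reflexivity_def by simp
  moreover have "monotonicity l (\<Inter> \<S>)"
    using sys unfolding pi2_rule_system_def monotonicity_def by simp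
  moreover have "alpha_renaming (\<Inter> \<S>)"
    using sys unfolding pi2_rule_system_def alpha_renaming_def by simp
  moreover have "rule_cut l (\<Inter> \<S>)"
    unfolding rule_cut_def
  proof (intro allI impI, elim conjE, rule InterI)
    fix \<Gamma> F \<Delta> G \<psi> S
    assume *: "\<forall>\<mu>\<in>\<Delta>. (\<Gamma>, \<mu>, F) \<in> \<Inter> \<S>" "(\<Delta>, \<psi>, G) \<in> \<Inter> \<S>" "finite \<Gamma>" "\<Gamma> \<subseteq> forms l"
      "finite F" "\<Union> (vars ` \<Gamma>) \<inter> G = {}" "vars \<psi> \<inter> (F \<union> G) = {}" and S: "S \<in> \<S>"
    have "rule_cut l S"
      using sys[OF S] by (simp add: pi2_rule_system_def)
    moreover have "\<forall>\<mu>\<in>\<Delta>. (\<Gamma>, \<mu>, F) \<in> S" "(\<Delta>, \<psi>, G) \<in> S"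
      using *(1,2) S by blast+
    ultimately show "(\<Gamma>, \<psi>, F) \<in> S"
      using *(3-7) unfolding rule_cut_def by blast
  qed
  moreover have "bound_structurality l (\<Inter> \<S>)"
    using sys unfolding pi2_rule_system_def bound_structurality_def by simp
  ultimately show ?thesis
    unfolding pi2_rule_system_def oplus_def \<S>_def by blast
qed

end

theory Submission
  imports Defs
begin

text \<open>The witness is the Lindenbaum--Tarski algebra of the formulas without letters in \<open>F\<close>, modulo
  provable equivalence in the theory \<open>T = {\<psi>. \<Gamma>/\<^sup>2\<psi> \<in> L \<oplus> \<Sigma>}\<close> with bound context \<open>F\<close>. Strong
  reflexivity puts every instance of \<open>\<Gamma>\<close> over these formulas into \<open>T\<close>, so the identity valuation
  refutes \<open>\<Gamma>/\<^sup>2\<phi>\<close>. A rule \<open>\<Delta>/\<^sup>2\<psi>\<close> of the system is valid because its universal premise may be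
  tested on fresh letters in place of the bound ones: then rule cut applies to the \<open>\<alpha>\<close>-renamed
  and substituted rule.\<close>

section \<open>Substitutions, evaluation, and equations coded as implications\<close>

lemma subst_cong: "(\<And>x. x \<in> vars \<phi> \<Longrightarrow> \<sigma> x = \<tau> x) \<Longrightarrow> subst \<sigma> \<phi> = subst \<tau> \<phi>"
  by (induction \<phi>) auto

lemma subst_Var: "subst Var \<phi> = \<phi>"
  by (induction \<phi>) auto

lemma subst_subst: "subst \<sigma> (subst \<tau> \<phi>) = subst (\<lambda>x. subst \<sigma> (\<tau> x)) \<phi>"
  by (induction \<phi>) auto

lemma forms_intros [simp]:
  "Bot \<in> forms l" "Top \<in> forms l"
  "a \<in> forms l \<Longrightarrow> b \<in> forms l \<Longrightarrow> Conj a b \<in> forms l"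
  "a \<in> forms l \<Longrightarrow> b \<in> forms l \<Longrightarrow> Disj a b \<in> forms l"
  "a \<in> forms l \<Longrightarrow> b \<in> forms l \<Longrightarrow> Impl a b \<in> forms l"
  by (cases l; simp)+

lemma Box_forms: "Box a \<in> forms l \<Longrightarrow> Box b \<in> forms l"
  by (cases l) auto

lemma lang_algebra_heyting: "lang_algebra l A \<Longrightarrow> heyting_algebra A"
  by (cases l) (auto simp: modal_algebra_def)

lemma eval_closed:
  assumes "lang_algebra l A" "valuation A v" "\<phi> \<in> forms l"
  shows "eval A v \<phi> \<in> carrier A"
proof -
  interpret heyting_algebra A using assms(1) by (rule lang_algebra_heyting)
  show ?thesis
    using assms
    by (cases l; induction \<phi>)
      (auto simp: valuation_def one_closed zero_closed meet_closed join_closed imp_closed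
        modal_algebra.box_closed)
qed

text \<open>Residuation with \<open>c\<close> taken to be \<open>one A\<close>, since only
  \<open>one A\<close> itself lies above \<open>one A\<close>.\<close>

lemma (in heyting_algebra) imp_eq_one_iff:
  assumes "a \<in> carrier A" "b \<in> carrier A"
  shows "imp A a b = one A \<longleftrightarrow> meet A a b = a"
proof -
  have "meet A (one A) x = x" if "x \<in> carrier A" for x
    using that meet_one meet_comm one_closed by metis
  then show ?thesis
    using residuation[OF assms one_closed] assms imp_closed by (auto simp: below_def)
qed

text \<open>Antisymmetry of the order, coded by two implications. Through this coding, equations
  that hold in \<open>K\<close> are expressed by membership of formulas in \<open>T\<close>.\<close>

lemma (in heyting_algebra) imp_both_eq_one_iff:
  assumes "a \<in> carrier A" "b \<in> carrier A"
  shows "imp A a b = one A \<and> imp A b a = one A \<longleftrightarrow> a = b"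
proof -
  have "meet A a a = a" if "a \<in> carrier A" for a
    using that meet_absorb[of a "meet A a a"] join_absorb[of a a] meet_closed by simp
  then show ?thesis
    using assms imp_eq_one_iff meet_comm[OF assms] by auto
qed

lemma validates_pi1_iff:
  "validates A (\<Gamma>, \<psi>, {}) \<longleftrightarrow>
    (\<forall>v. valuation A v \<longrightarrow> (\<forall>\<phi>\<in>\<Gamma>. eval A v \<phi> = one A) \<longrightarrow> eval A v \<psi> = one A)"
proof -
  have "(\<forall>x. v' x = v x) \<longleftrightarrow> v' = v" for v v' :: "nat \<Rightarrow> 'a"
    by auto
  then show ?thesis
    by (auto simp: validates_def)
qed

section \<open>Cut and instances inside an arbitrary rule system\<close>

lemma pi2_system_rules: "pi2_rule_system l S \<Longrightarrow> S \<subseteq> pi2_rules l"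
  by (simp add: pi2_rule_system_def)

text \<open>Rule cut also asks that \<open>\<psi>\<close> avoid \<open>G\<close>; this follows from
  \<open>(\<Delta>, \<psi>, G)\<close> being itself a rule.\<close>

lemma pi2_system_cut:
  assumes "pi2_rule_system l S" "(\<Delta>, \<psi>, G) \<in> S" "\<And>\<mu>. \<mu> \<in> \<Delta> \<Longrightarrow> (\<Gamma>, \<mu>, F) \<in> S"
    "finite \<Gamma>" "\<Gamma> \<subseteq> forms l" "finite F" "\<Union> (vars ` \<Gamma>) \<inter> G = {}" "vars \<psi> \<inter> F = {}"
  shows "(\<Gamma>, \<psi>, F) \<in> S"
proof -
  have "vars \<psi> \<inter> (F \<union> G) = {}"
    using assms(1,2,8) by (fastforce simp: pi2_rules_def dest!: pi2_system_rules)
  moreover have "rule_cut l S"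
    using assms(1) by (simp add: pi2_rule_system_def)
  ultimately show ?thesis
    using assms(2-7) unfolding rule_cut_def by blast
qed

text \<open>With an empty bound context, a premise comes from strong reflexivity, and applying a
  rule of \<open>L\<close> is bound structurality followed by cut; the side conditions on bound
  letters are vacuous.\<close>

lemma derivable_in_system:
  assumes S: "pi2_rule_system l S" and L: "L \<subseteq> S"
    and \<Gamma>: "finite \<Gamma>" "\<Gamma> \<subseteq> forms l"
    and "derivable l L \<Gamma> \<psi>"
  shows "(\<Gamma>, \<psi>, {}) \<in> S"
  using assms(5)
proof induction
  case (premise \<phi>)
  \<comment> \<open>Strong reflexivity substitutes for bound letters only, so here its substitution
    is the identity.\<close>
  then have "(\<Gamma>, subst (\<lambda>x. if x \<in> {} then Var x else Var x) \<phi>, {}) \<in> S"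
    using S \<Gamma> unfolding pi2_rule_system_def strong_reflexivity_def by blast
  then show ?case by (simp add: subst_Var)
next
  case (rule \<Delta> \<psi> \<sigma>)
  have "bound_structurality l S"
    using S by (simp add: pi2_rule_system_def)
  then have "(subst \<sigma> ` \<Delta>, subst \<sigma> \<psi>, {}) \<in> S"
    using rule.hyps L
      bound_structurality_def[THEN iffD1, rule_format, of l S \<Delta> \<psi> "{}" \<sigma>] by auto
  then show ?case
    by (rule pi2_system_cut[OF S]) (use rule.IH \<Gamma> in auto)
qed

text \<open>\<open>\<alpha>\<close>-renaming first moves the bound letters away from the letters introduced by \<open>s\<close>.\<close>

lemma fresh_instance_in_system:
  assumes S: "pi2_rule_system l S" and R: "(\<Delta>, \<psi>, G) \<in> S"
    and s: "substitution l s" and "inj_on f G"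
    and fresh: "\<And>q. q \<in> \<Union> (vars ` \<Delta>) \<union> vars \<psi> \<Longrightarrow> f ` G \<inter> ({q} \<union> vars (s q)) = {}"
  shows "(subst (\<lambda>x. if x \<in> G then Var (f x) else s x) ` \<Delta>, subst s \<psi>, f ` G) \<in> S"
proof -
  define \<rho> where "\<rho> = (\<lambda>x. if x \<in> G then Var (f x) else Var x)"
  \<comment> \<open>Bound structurality requires the new bound letters to be fixed; by freshness
    \<open>\<sigma>\<close> still agrees with \<open>s\<close> on the letters of
    \<open>\<psi>\<close> and on the free letters of the renamed premises.\<close>
  define \<sigma> where "\<sigma> = (\<lambda>x. if x \<in> f ` G then Var x else s x)"
  have "alpha_renaming S" and bs: "bound_structurality l S"
    using S by (simp_all add: pi2_rule_system_def)
  moreover have "f ` G \<inter> free_vars \<Delta> G = {}" "f ` G \<inter> vars \<psi> = {}"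
    using fresh by (auto simp: free_vars_def)
  ultimately have renamed: "(subst \<rho> ` \<Delta>, \<psi>, f ` G) \<in> S"
    using R \<open>inj_on f G\<close> unfolding alpha_renaming_def \<rho>_def by blast
  have \<psi>: "subst \<sigma> \<psi> = subst s \<psi>"
    using fresh by (intro subst_cong) (auto simp: \<sigma>_def)
  have "(subst \<sigma> ` subst \<rho> ` \<Delta>, subst \<sigma> \<psi>, f ` G) \<in> S"
  proof -
    have "substitution l \<sigma>"
      using s by (simp add: substitution_def \<sigma>_def)
    moreover have "vars (\<sigma> q) \<inter> f ` G = {}" if "q \<in> free_vars (subst \<rho> ` \<Delta>) (f ` G)" for q
    proof -
      \<comment> \<open>A letter that is free after the renaming was already a letter of
        \<open>\<Delta>\<close>, so the freshness assumption controls \<open>s q\<close>.\<close>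
      have "q \<in> \<Union> (vars ` \<Delta>)" "q \<notin> f ` G"
        using that by (auto simp: free_vars_def vars_subst \<rho>_def split: if_splits)
      then show ?thesis
        using fresh[of q] by (auto simp: \<sigma>_def)
    qed
    moreover have "vars (subst \<sigma> \<psi>) \<inter> f ` G = {}"
      using fresh unfolding \<psi> by (fastforce simp: vars_subst)
    moreover have "\<forall>p\<in>f ` G. \<sigma> p = Var p"
      by (simp add: \<sigma>_def)
    ultimately show ?thesis
      using bs[unfolded bound_structurality_def, rule_format, OF conjI[OF renamed]] by simp
  qed
  moreover have "subst \<sigma> (subst \<rho> \<delta>) = subst (\<lambda>x. if x \<in> G then Var (f x) else s x) \<delta>"
    if "\<delta> \<in> \<Delta>" for \<delta>
    unfolding subst_subst using that fresh by (intro subst_cong) (auto simp: \<rho>_def \<sigma>_def)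
  ultimately show ?thesis
    by (simp add: \<psi> image_image cong: image_cong)
qed

section \<open>The theory \<open>T\<close> and the quotient of \<open>Fm\<close>\<close>

locale lindenbaum =
  fixes l :: lang and L S :: "pi2_rule set" and K :: "'a alg set"
    and \<Gamma> :: "fm set" and F :: "nat set"
  assumes system: "pi2_rule_system l S" and L_S: "L \<subseteq> S"
    and algebraized: "algebraized_by l L K"
    and \<Gamma>: "finite \<Gamma>" "\<Gamma> \<subseteq> forms l" and finite_F: "finite F"
begin

text \<open>Conclusions of rules with bound context \<open>F\<close> avoid \<open>F\<close>, and
  strong reflexivity substitutes only such formulas for the letters of \<open>F\<close>; so
  \<open>T\<close> lives inside \<open>Fm\<close>.\<close>

definition Fm :: "fm set" where
  "Fm = {a \<in> forms l. vars a \<inter> F = {}}"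

definition T :: "fm set" where
  "T = {\<psi>. (\<Gamma>, \<psi>, F) \<in> S}"

definition cls :: "fm \<Rightarrow> fm set" where
  "cls a = {b \<in> Fm. Impl a b \<in> T \<and> Impl b a \<in> T}"

text \<open>A choice of representatives, through which \<open>alg\<close> is defined on classes;
  \<open>alg_ops\<close> and \<open>alg_box\<close> show that the choice is immaterial.\<close>

definition rep :: "fm set \<Rightarrow> fm" where
  "rep X = (SOME a. a \<in> Fm \<and> cls a = X)"

definition alg :: "fm set alg" where
  "alg = \<lparr>carrier = cls ` Fm, one = cls Top, zero = cls Bot,
    meet = (\<lambda>X Y. cls (Conj (rep X) (rep Y))),
    join = (\<lambda>X Y. cls (Disj (rep X) (rep Y))),
    imp = (\<lambda>X Y. cls (Impl (rep X) (rep Y))),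
    box = (\<lambda>X. cls (Box (rep X)))\<rparr>"

lemma Fm_intros [simp]:
  "Bot \<in> Fm" "Top \<in> Fm"
  "a \<in> Fm \<Longrightarrow> b \<in> Fm \<Longrightarrow> Conj a b \<in> Fm"
  "a \<in> Fm \<Longrightarrow> b \<in> Fm \<Longrightarrow> Disj a b \<in> Fm"
  "a \<in> Fm \<Longrightarrow> b \<in> Fm \<Longrightarrow> Impl a b \<in> Fm"
  "Box a \<in> forms l \<Longrightarrow> a \<in> Fm \<Longrightarrow> Box a \<in> Fm"
  by (auto simp: Fm_def)

lemma K_heyting: "A \<in> K \<Longrightarrow> heyting_algebra A"
  and K_algebra: "A \<in> K \<Longrightarrow> lang_algebra l A"
  using algebraized lang_algebra_heyting by (auto simp: algebraized_by_def)

lemma T_Fm: "T \<subseteq> Fm"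
  using pi2_system_rules[OF system] by (auto simp: T_def Fm_def pi2_rules_def)

text \<open>Completeness of \<open>L\<close> for \<open>K\<close> turns a consequence over
  \<open>K\<close> into a derivation, hence into a rule of \<open>S\<close> with empty bound
  context. Its premises lie in \<open>T\<close>, so cut replaces them by
  \<open>\<Gamma>\<close>.\<close>

lemma T_consequence:
  assumes "\<Delta> \<subseteq> T" "finite \<Delta>" "\<psi> \<in> Fm"
    and "\<And>A v. A \<in> K \<Longrightarrow> valuation A v \<Longrightarrow> \<forall>\<delta>\<in>\<Delta>. eval A v \<delta> = one A \<Longrightarrow>
      eval A v \<psi> = one A"
  shows "\<psi> \<in> T"
proof -
  have \<Delta>: "\<Delta> \<subseteq> forms l"
    using assms(1) T_Fm by (auto simp: Fm_def)
  then have "(\<Delta>, \<psi>, {}) \<in> pi1_rules l"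
    using assms(2,3) by (auto simp: pi1_rules_def pi2_rules_def Fm_def)
  then have "derivable l L \<Delta> \<psi>"
    using algebraized assms(4) by (simp add: algebraized_by_def validates_pi1_iff)
  then have "(\<Delta>, \<psi>, {}) \<in> S"
    using derivable_in_system[OF system L_S assms(2) \<Delta>] by blast
  then have "(\<Gamma>, \<psi>, F) \<in> S"
    by (rule pi2_system_cut[OF system])
      (use assms(1,3) \<Gamma> finite_F in \<open>auto simp: T_def Fm_def\<close>)
  then show ?thesis by (simp add: T_def)
qed

section \<open>Transfer of quasi-equations from \<open>K\<close> to provable equivalence\<close>

lemma eval_Impl_one_iff:
  assumes "A \<in> K" "valuation A v" "a \<in> Fm" "b \<in> Fm"
  shows "eval A v (Impl a b) = one A \<and> eval A v (Impl b a) = one A \<longleftrightarrow> eval A v a = eval A v b"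
  using heyting_algebra.imp_both_eq_one_iff[OF K_heyting[OF assms(1)]]
    eval_closed[OF K_algebra[OF assms(1)] assms(2)] assms(3,4)
  by (simp add: Fm_def)

text \<open>A finite quasi-equation holding throughout \<open>K\<close> carries over to provable
  equivalence: \<open>E\<close> lists its premises, each coded by two implications. The congruence
  and algebra laws below arise by choosing \<open>E\<close>.\<close>

lemma equiv_consequence:
  assumes "a \<in> Fm" "b \<in> Fm" "finite E" "E \<subseteq> Fm \<times> Fm"
    and "\<And>s t. (s, t) \<in> E \<Longrightarrow> t \<in> cls s"
    and "\<And>A v. A \<in> K \<Longrightarrow> valuation A v \<Longrightarrow> \<forall>(s, t)\<in>E. eval A v s = eval A v t \<Longrightarrow>
      eval A v a = eval A v b"
  shows "b \<in> cls a"
proof -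
  define \<Delta> where "\<Delta> = (\<Union>(s, t)\<in>E. {Impl s t, Impl t s})"
  have \<Delta>: "\<Delta> \<subseteq> T" "finite \<Delta>"
    using assms(3,5) by (auto simp: \<Delta>_def cls_def)
  have "eval A v (Impl a b) = one A \<and> eval A v (Impl b a) = one A"
    if A: "A \<in> K" "valuation A v" and one: "\<forall>\<delta>\<in>\<Delta>. eval A v \<delta> = one A" for A v
  proof -
    have "eval A v s = eval A v t" if "(s, t) \<in> E" for s t
    proof -
      have "s \<in> Fm" "t \<in> Fm" "Impl s t \<in> \<Delta>" "Impl t s \<in> \<Delta>"
        using that assms(4) by (auto simp: \<Delta>_def)
      then show ?thesis
        using eval_Impl_one_iff[OF A] one by blast
    qed
    then show ?thesis
      using assms(6)[OF A] eval_Impl_one_iff[OF A assms(1,2)] by blast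
  qed
  then have "Impl a b \<in> T" "Impl b a \<in> T"
    using assms(1,2) by (auto intro!: T_consequence[OF \<Delta>])
  then show ?thesis
    using assms(2) by (simp add: cls_def)
qed

lemma cls_refl: "a \<in> Fm \<Longrightarrow> a \<in> cls a"
  by (rule equiv_consequence[where E = "{}"]) auto

text \<open>Symmetry and transitivity of equality are quasi-equations, so both inclusions between
  the classes are instances of the transfer.\<close>

lemma cls_eq_iff: "a \<in> Fm \<Longrightarrow> b \<in> Fm \<Longrightarrow> cls a = cls b \<longleftrightarrow> b \<in> cls a"
proof
  assume ab: "a \<in> Fm" "b \<in> Fm" and b: "b \<in> cls a"
  have "c \<in> cls a \<longleftrightarrow> c \<in> cls b" for c
  proof
    assume c: "c \<in> cls a"
    show "c \<in> cls b"
      by (rule equiv_consequence[where E = "{(a, b), (a, c)}"]) (use ab b c in \<open>auto simp: cls_def\<close>)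
  next
    assume c: "c \<in> cls b"
    show "c \<in> cls a"
      by (rule equiv_consequence[where E = "{(a, b), (b, c)}"]) (use ab b c in \<open>auto simp: cls_def\<close>)
  qed
  then show "cls a = cls b" by blast
qed (use cls_refl in blast)

lemma cls_eqI:
  assumes "a \<in> Fm" "b \<in> Fm" "finite E" "E \<subseteq> Fm \<times> Fm"
    and "\<And>s t. (s, t) \<in> E \<Longrightarrow> cls s = cls t"
    and "\<And>A v. A \<in> K \<Longrightarrow> valuation A v \<Longrightarrow> \<forall>(s, t)\<in>E. eval A v s = eval A v t \<Longrightarrow>
      eval A v a = eval A v b"
  shows "cls a = cls b"
proof -
  have "t \<in> cls s" if "(s, t) \<in> E" for s t
    using that assms(4,5) cls_eq_iff by blast
  then show ?thesis
    using equiv_consequence[OF assms(1-4) _ assms(6)] cls_eq_iff[OF assms(1,2)] by blast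
qed

lemma cls_identity:
  assumes "a \<in> Fm" "b \<in> Fm"
    and "\<And>A v. A \<in> K \<Longrightarrow> valuation A v \<Longrightarrow> eval A v a = eval A v b"
  shows "cls a = cls b"
  by (rule cls_eqI[where E = "{}"]) (use assms in auto)

text \<open>In a member of \<open>K\<close>, \<open>a\<close> has value 1 exactly when both
  implications between \<open>a\<close> and \<open>Top\<close> do; so \<open>T\<close> becomes the
  unit of the quotient.\<close>

lemma cls_eq_one_iff: "a \<in> Fm \<Longrightarrow> cls a = cls Top \<longleftrightarrow> a \<in> T"
proof
  assume a: "a \<in> Fm" and "cls a = cls Top"
  then have "Impl a Top \<in> T" "Impl Top a \<in> T"
    using cls_eq_iff by (auto simp: cls_def)
  then show "a \<in> T"
    by (intro T_consequence[where \<Delta> = "{Impl a Top, Impl Top a}"])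
      (use a eval_Impl_one_iff[of _ _ a Top] in auto)
next
  assume a: "a \<in> Fm" and T: "a \<in> T"
  have one: "eval A v (Impl a Top) = one A \<and> eval A v (Impl Top a) = one A"
    if "A \<in> K" "valuation A v" "eval A v a = one A" for A v
    using eval_Impl_one_iff[OF that(1,2) a, of Top] that(3) by simp
  have "Impl a Top \<in> T" "Impl Top a \<in> T"
    by (rule T_consequence[where \<Delta> = "{a}"]; use a T one in auto)+
  then show "cls a = cls Top"
    using a by (subst cls_eq_iff) (auto simp: cls_def)
qed

lemma rep: "a \<in> Fm \<Longrightarrow> rep (cls a) \<in> Fm \<and> cls (rep (cls a)) = cls a"
  unfolding rep_def by (rule someI) simp

section \<open>The operations and laws of the quotient algebra\<close>

lemma alg_simps [simp]:
  "carrier alg = cls ` Fm" "one alg = cls Top" "zero alg = cls Bot"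
  by (simp_all add: alg_def)

text \<open>With \<open>E\<close> pairing each chosen representative with the given formula, the
  congruence property is replacement of equals in the members of \<open>K\<close>.\<close>

lemma alg_ops [simp]:
  assumes "a \<in> Fm" "b \<in> Fm"
  shows "meet alg (cls a) (cls b) = cls (Conj a b)"
    and "join alg (cls a) (cls b) = cls (Disj a b)"
    and "imp alg (cls a) (cls b) = cls (Impl a b)"
  unfolding alg_def alg.simps
  by (rule cls_eqI[where E = "{(rep (cls a), a), (rep (cls b), b)}"];
      use assms rep in auto)+

lemma alg_box [simp]: "Box a \<in> forms l \<Longrightarrow> a \<in> Fm \<Longrightarrow> box alg (cls a) = cls (Box a)"
  unfolding alg_def alg.simps
  by (rule cls_eqI[where E = "{(rep (cls a), a)}"]; use rep Box_forms in auto)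

lemma eval_closed_K: "A \<in> K \<Longrightarrow> valuation A v \<Longrightarrow> a \<in> Fm \<Longrightarrow> eval A v a \<in> carrier A"
  using eval_closed[OF K_algebra] by (simp add: Fm_def)

lemma heyting_alg: "heyting_algebra alg"
proof
  fix X Y Z
  assume "X \<in> carrier alg" "Y \<in> carrier alg" "Z \<in> carrier alg"
  then obtain a b c where abc: "X = cls a" "Y = cls b" "Z = cls c" "a \<in> Fm" "b \<in> Fm" "c \<in> Fm"
    by auto
  show "meet alg (meet alg X Y) Z = meet alg X (meet alg Y Z)"
    using abc by (simp, intro cls_identity) (auto intro!: heyting_algebra.meet_assoc K_heyting eval_closed_K)
  show "join alg (join alg X Y) Z = join alg X (join alg Y Z)"
    using abc by (simp, intro cls_identity) (auto intro!: heyting_algebra.join_assoc K_heyting eval_closed_K)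
  have res: "meet A (meet A z x) y = meet A z x \<longleftrightarrow> meet A z (imp A x y) = z"
    if "A \<in> K" "x \<in> carrier A" "y \<in> carrier A" "z \<in> carrier A" for A x y z
    using heyting_algebra.residuation[OF K_heyting] that by (simp add: below_def)
  \<comment> \<open>Residuation is an equivalence between equations, so each direction is
    transferred as a quasi-equation with one premise; the other laws are plain identities.\<close>
  have "cls (Conj (Conj c a) b) = cls (Conj c a) \<longleftrightarrow> cls (Conj c (Impl a b)) = cls c"
  proof
    assume eq: "cls (Conj (Conj c a) b) = cls (Conj c a)"
    show "cls (Conj c (Impl a b)) = cls c"
      by (rule cls_eqI[where E = "{(Conj (Conj c a) b, Conj c a)}"])
        (use abc eq res eval_closed_K in auto)
  next
    assume eq: "cls (Conj c (Impl a b)) = cls c"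
    show "cls (Conj (Conj c a) b) = cls (Conj c a)"
      by (rule cls_eqI[where E = "{(Conj c (Impl a b), c)}"])
        (use abc eq res eval_closed_K in auto)
  qed
  then show "below alg (meet alg Z X) Y \<longleftrightarrow> below alg Z (imp alg X Y)"
    using abc by (simp add: below_def)
next
  fix X Y
  assume "X \<in> carrier alg" "Y \<in> carrier alg"
  then obtain a b where ab: "X = cls a" "Y = cls b" "a \<in> Fm" "b \<in> Fm"
    by auto
  show "meet alg X Y = meet alg Y X"
    using ab by (simp, intro cls_identity) (auto intro!: heyting_algebra.meet_comm K_heyting eval_closed_K)
  show "join alg X Y = join alg Y X"
    using ab by (simp, intro cls_identity) (auto intro!: heyting_algebra.join_comm K_heyting eval_closed_K)
  show "meet alg X (join alg X Y) = X"
    using ab by (simp, intro cls_identity) (auto intro!: heyting_algebra.meet_absorb K_heyting eval_closed_K)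
  show "join alg X (meet alg X Y) = X"
    using ab by (simp, intro cls_identity) (auto intro!: heyting_algebra.join_absorb K_heyting eval_closed_K)
  show "meet alg X (one alg) = X"
    using ab by (simp, intro cls_identity) (auto intro!: heyting_algebra.meet_one K_heyting eval_closed_K)
  show "join alg X (zero alg) = X"
    using ab by (simp, intro cls_identity) (auto intro!: heyting_algebra.join_zero K_heyting eval_closed_K)
qed auto

lemma lang_algebra_alg: "lang_algebra l alg"
proof (cases l)
  case Intuitionistic
  then show ?thesis using heyting_alg by simp
next
  case Modal
  have K: "modal_algebra A" if "A \<in> K" for A
    using K_algebra[OF that] Modal by simp
  have box: "Box a \<in> forms l" for a
    using Modal by simp
  interpret heyting_algebra alg by (rule heyting_alg)
  have "modal_algebra alg"
  proof
    fix X Y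
    assume "X \<in> carrier alg" "Y \<in> carrier alg"
    then obtain a b where ab: "X = cls a" "Y = cls b" "a \<in> Fm" "b \<in> Fm"
      by auto
    show "join alg X (imp alg X (zero alg)) = one alg"
      using ab by (simp, intro cls_identity) (auto intro!: modal_algebra.excluded_middle K eval_closed_K)
    show "box alg (meet alg X Y) = meet alg (box alg X) (box alg Y)"
      using ab box by (simp, intro cls_identity) (auto intro!: modal_algebra.box_meet K eval_closed_K)
    show "box alg X \<in> carrier alg"
      using ab box by simp
  next
    show "box alg (one alg) = one alg"
      using box by (simp, intro cls_identity) (auto intro!: modal_algebra.box_one K)
  qed
  then show ?thesis using Modal by simp
qed

section \<open>Valuations as substitutions, and validity of the system\<close>

lemma subst_Fm: "\<psi> \<in> forms l \<Longrightarrow> (\<And>x. t x \<in> Fm) \<Longrightarrow> subst t \<psi> \<in> Fm"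
  by (auto simp: Fm_def vars_subst intro!: subst_forms)

text \<open>The truth lemma: as the operations may be computed on any representatives, evaluating
  amounts to substituting representatives and then taking the class.\<close>

lemma eval_alg:
  assumes "\<And>x. v x = cls (t x)" "\<And>x. t x \<in> Fm" "\<psi> \<in> forms l"
  shows "eval alg v \<psi> = cls (subst t \<psi>)"
  using assms(3)
proof (induction \<psi>)
  case (Box \<psi>)
  then have "\<psi> \<in> forms l" by (cases l) auto
  then show ?case
    using Box assms(2) Box_forms by (simp add: subst_Fm)
next
  case (Conj a b)
  then have "a \<in> forms l" "b \<in> forms l" by (cases l; simp)+
  then show ?case using Conj assms(2) by (simp add: subst_Fm)
next
  case (Disj a b)
  then have "a \<in> forms l" "b \<in> forms l" by (cases l; simp)+
  then show ?case using Disj assms(2) by (simp add: subst_Fm)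
next
  case (Impl a b)
  then have "a \<in> forms l" "b \<in> forms l" by (cases l; simp)+
  then show ?case using Impl assms(2) by (simp add: subst_Fm)
qed (use assms in simp_all)

lemma eval_alg_one_iff:
  assumes "\<And>x. v x = cls (t x)" "\<And>x. t x \<in> Fm" "\<psi> \<in> forms l"
  shows "eval alg v \<psi> = one alg \<longleftrightarrow> subst t \<psi> \<in> T"
  using eval_alg[OF assms] cls_eq_one_iff subst_Fm assms(2,3) by simp

lemma rep_valuation:
  assumes "valuation alg v"
  shows "rep (v x) \<in> Fm" "cls (rep (v x)) = v x"
  using assms rep unfolding valuation_def by (auto dest!: spec[of _ x])

lemma validates_system:
  assumes R: "(\<Delta>, \<psi>, G) \<in> S"
  shows "validates alg (\<Delta>, \<psi>, G)"
  unfolding validates_def satisfies.simps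
proof (intro allI impI)
  fix v
  assume v: "valuation alg v"
    and prem: "\<forall>\<delta>\<in>\<Delta>. \<forall>v'. valuation alg v' \<and> (\<forall>x. x \<notin> G \<longrightarrow> v' x = v x) \<longrightarrow> eval alg v' \<delta> = one alg"
  define s where "s = (\<lambda>x. rep (v x))"
  have s: "s x \<in> Fm" "v x = cls (s x)" for x
    using rep_valuation[OF v] by (simp_all add: s_def)
  have rule: "finite \<Delta>" "\<Delta> \<subseteq> forms l" "\<psi> \<in> forms l" "finite G"
    using R pi2_system_rules[OF system] by (auto simp: pi2_rules_def)
  define Q where "Q = \<Union> (vars ` \<Delta>) \<union> vars \<psi>"
  \<comment> \<open>The new letters must avoid \<open>F\<close> to lie in \<open>Fm\<close>, the
    letters of \<open>\<Gamma>\<close> for the cut, and \<open>Q\<close> with the letters of its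
    \<open>s\<close>-values for \<open>fresh_instance_in_system\<close>. As \<open>Q\<close> is
    finite, so is \<open>X\<close>.\<close>
  define X where "X = F \<union> \<Union> (vars ` \<Gamma>) \<union> Q \<union> (\<Union>q\<in>Q. vars (s q))"
  have "finite X"
    using rule finite_F \<Gamma> by (auto simp: X_def Q_def finite_vars)
  then obtain N where N: "\<And>x. x \<in> X \<Longrightarrow> x < N"
    by (auto simp: finite_nat_set_iff_bounded)
  \<comment> \<open>Shifting by \<open>N\<close> is injective and lands above every element of
    \<open>X\<close>.\<close>
  define f where "f = (\<lambda>x. x + N)"
  have fX: "f x \<notin> X" for x
    using N[of "f x"] by (auto simp: f_def)
  \<comment> \<open>The generic test of the universal premise: free letters keep the value given by
    \<open>v\<close>, bound letters become distinct fresh letters.\<close>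
  define t where "t = (\<lambda>x. if x \<in> G then Var (f x) else s x)"
  have t: "t x \<in> Fm" for x
    using s fX[of x] by (auto simp: t_def Fm_def X_def)
  have inst: "(subst t ` \<Delta>, subst s \<psi>, f ` G) \<in> S"
    unfolding t_def
  proof (rule fresh_instance_in_system[OF system R])
    show "substitution l s"
      using s by (simp add: substitution_def Fm_def)
    show "inj_on f G"
      by (simp add: inj_on_def f_def)
    show "f ` G \<inter> ({q} \<union> vars (s q)) = {}" if "q \<in> \<Union> (vars ` \<Delta>) \<union> vars \<psi>" for q
      using that fX by (auto simp: X_def Q_def)
  qed
  have "subst t \<delta> \<in> T" if "\<delta> \<in> \<Delta>" for \<delta>
  proof -
    have "valuation alg (\<lambda>x. cls (t x))"
      using t by (simp add: valuation_def)
    moreover have "\<forall>x. x \<notin> G \<longrightarrow> cls (t x) = v x"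
      using s by (simp add: t_def)
    ultimately have "eval alg (\<lambda>x. cls (t x)) \<delta> = one alg"
      using prem that by blast
    then show ?thesis
      using eval_alg_one_iff[of "\<lambda>x. cls (t x)" t \<delta>] t that rule by auto
  qed
  \<comment> \<open>The premises of \<open>inst\<close> are the tested formulas, now known to lie in
    \<open>T\<close>, and its bound letters do not occur in \<open>\<Gamma>\<close>.\<close>
  then have "(\<Gamma>, subst s \<psi>, F) \<in> S"
    by (intro pi2_system_cut[OF system inst])
      (use \<Gamma> finite_F subst_Fm[OF rule(3) s(1)] fX in \<open>auto simp: T_def Fm_def X_def\<close>)
  then show "eval alg v \<psi> = one alg"
    using eval_alg_one_iff[of v s] s rule by (simp add: T_def)
qed

section \<open>Refutation of the given rule\<close>

lemma refutes:
  assumes "(\<Gamma>, \<phi>, F) \<in> pi2_rules l" "(\<Gamma>, \<phi>, F) \<notin> S"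
  shows "\<not> validates alg (\<Gamma>, \<phi>, F)"
proof
  \<comment> \<open>Letters of \<open>F\<close> are not in \<open>Fm\<close>, so the identity
    valuation takes the default \<open>Top\<close> there. \<open>\<phi>\<close> has no such letters
    and evaluates to its own class, which is not the unit because \<open>\<phi>\<close> is not in
    \<open>T\<close>.\<close>
  define t where "t = (\<lambda>x. if x \<in> F then Top else Var x)"
  define v where "v = (\<lambda>x. cls (t x))"
  have t: "t x \<in> Fm" for x
    by (simp add: t_def Fm_def)
  have \<phi>: "\<phi> \<in> forms l" "F \<inter> vars \<phi> = {}"
    using assms(1) by (auto simp: pi2_rules_def)
  have "subst t \<phi> = subst Var \<phi>"
    using \<phi>(2) by (intro subst_cong) (auto simp: t_def)
  then have "eval alg v \<phi> \<noteq> one alg"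
    using eval_alg_one_iff[of v t \<phi>] t \<phi> assms(2) by (simp add: v_def T_def subst_Var)
  moreover have "eval alg v' \<gamma> = one alg"
    if \<gamma>: "\<gamma> \<in> \<Gamma>" and v': "valuation alg v'" "\<forall>x. x \<notin> F \<longrightarrow> v' x = v x" for \<gamma> v'
  proof -
    define u where "u = (\<lambda>x. if x \<in> F then rep (v' x) else Var x)"
    have u: "u x \<in> Fm" "v' x = cls (u x)" for x
      using rep_valuation[OF v'(1)] v'(2) by (auto simp: u_def v_def t_def Fm_def)
    have "\<forall>p\<in>F. rep (v' p) \<in> forms l \<and> vars (rep (v' p)) \<inter> F = {}"
      using rep_valuation[OF v'(1)] by (auto simp: Fm_def)
    moreover have "strong_reflexivity l S"
      using system by (simp add: pi2_rule_system_def)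
    ultimately have "(\<Gamma>, subst u \<gamma>, F) \<in> S"
      using \<gamma> \<Gamma> finite_F
        strong_reflexivity_def[THEN iffD1, rule_format, of l S \<Gamma> F \<gamma> "\<lambda>x. rep (v' x)"]
      by (simp add: u_def)
    then show ?thesis
      using eval_alg_one_iff[of v' u \<gamma>] u \<gamma> \<Gamma> by (auto simp: T_def)
  qed
  moreover have "valuation alg v"
    using t by (simp add: valuation_def v_def)
  moreover assume "validates alg (\<Gamma>, \<phi>, F)"
  ultimately show False
    unfolding validates_def satisfies.simps by blast
qed

end

theorem theorem4p3:
  fixes l :: lang
    and L \<Sigma> :: "pi2_rule set"
    and K :: "'a alg set"
    and \<Gamma> :: "fm set" and \<phi> :: fm and F :: "nat set"
  assumes "L \<subseteq> pi1_rules l"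
    and "algebraized_by l L K"
    and "\<Sigma> \<subseteq> pi2_rules l"
    and "(\<Gamma>, \<phi>, F) \<in> pi2_rules l"
    and "(\<Gamma>, \<phi>, F) \<notin> oplus l L \<Sigma>"
  shows "\<exists>A :: fm set alg. lang_algebra l A \<and> (\<forall>R \<in> oplus l L \<Sigma>. validates A R) \<and>
    \<not> validates A (\<Gamma>, \<phi>, F)"
proof -
  have "L \<subseteq> pi2_rules l"
    using assms(1) by (auto simp: pi1_rules_def)
  \<comment> \<open>Closure under intersections makes \<open>oplus l L \<Sigma>\<close> a rule
    system, and it contains \<open>L\<close> because every system intersected does.\<close>
  then interpret lindenbaum l L "oplus l L \<Sigma>" K \<Gamma> F
    using pi2_rule_system_oplus assms
    by unfold_locales (auto simp: pi2_rules_def oplus_def)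
  show ?thesis
    using lang_algebra_alg validates_system refutes[OF assms(4,5)] by auto
qed

end
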